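(* Let $G$ be a finite group. Then $\Gamma(G)$ is regular if and only if $G$ is a cyclic group of square-free order.
   Context: For a finite group $G$, the cyclic subgroup graph $\Gamma(G)$ is the simple undirected graph whose vertex set is $C(G)$, the set of all cyclic subgroups of $G$ (including the trivial subgroup $\{e\}$), and in which two distinct vertices are adjacent if and only if one of them, $H_1$, is contained in the other, $H_2$, and there is no subgroup $K$ of $G$ with $H_1<K<H_2$ (strict inclusions). A graph is regular if all its vertices have the same degree. *)

theory Defs
  imports
    "HOL-Algebra.Elementary_Groups"
    "HOL-Computational_Algebra.Squarefree"
    "Graph_Theory.Pair_Digraph"
begin

definition cyclic_subgroups :: "('a, 'b) monoid_scheme \<Rightarrow> 'a set set" where
  "cyclic_subgroups G = {H. subgroup H G \<and> cyclic_group (G\<lparr>carrier := H\<rparr>)}"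

text \<open>The intermediate group \<open>K\<close> ranges over all subgroups of \<open>G\<close>, not only the cyclic ones.\<close>

definition covered_by :: "('a, 'b) monoid_scheme \<Rightarrow> 'a set \<Rightarrow> 'a set \<Rightarrow> bool" where
  "covered_by G H1 H2 \<longleftrightarrow> H1 \<subset> H2 \<and> \<not> (\<exists>K. subgroup K G \<and> H1 \<subset> K \<and> K \<subset> H2)"

text \<open>As usual in \<open>Graph_Theory\<close>, an undirected graph is a symmetric digraph: each edge
  is represented by the two arcs \<open>(H1, H2)\<close> and \<open>(H2, H1)\<close>.\<close>

definition cyclic_subgroup_graph :: "('a, 'b) monoid_scheme \<Rightarrow> 'a set pair_pre_digraph" where
  "cyclic_subgroup_graph G =
    \<lparr> pverts = cyclic_subgroups G,
      parcs = {(H1, H2). H1 \<in> cyclic_subgroups G \<and> H2 \<in> cyclic_subgroups G \<and>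
                 (covered_by G H1 H2 \<or> covered_by G H2 H1)} \<rparr>"

text \<open>Since both arcs of an edge are present, the degree of a vertex in the undirected graph
  is its out-degree, not the sum of its in-degree and out-degree.\<close>

definition regular_graph :: "'v pair_pre_digraph \<Rightarrow> bool" where
  "regular_graph \<Gamma> \<longleftrightarrow> (\<exists>d. \<forall>v \<in> pverts \<Gamma>. out_degree (with_proj \<Gamma>) v = d)"

lemma finite_cyclic_subgroups:
  assumes "finite (carrier G)"
  shows "finite (cyclic_subgroups G)"
proof (rule finite_subset)
  show "cyclic_subgroups G \<subseteq> Pow (carrier G)"
    by (auto simp: cyclic_subgroups_def dest: subgroup.subset)
qed (use assms in simp)

lemma pair_graph_cyclic_subgroup_graph:
  assumes "finite (carrier G)"
  shows "pair_graph (cyclic_subgroup_graph G)"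
proof -
  have "parcs (cyclic_subgroup_graph G) \<subseteq> cyclic_subgroups G \<times> cyclic_subgroups G"
    by (auto simp: cyclic_subgroup_graph_def)
  then have "finite (parcs (cyclic_subgroup_graph G))"
    by (rule finite_subset) (simp add: finite_cyclic_subgroups assms)
  then show ?thesis
    by unfold_locales
      (auto simp: cyclic_subgroup_graph_def covered_by_def finite_cyclic_subgroups assms
         symmetric_def arcs_ends_def arc_to_ends_def intro!: symI)
qed

lemma out_degree_cyclic_subgroup_graph:
  assumes "H \<in> cyclic_subgroups G"
  shows "out_degree (with_proj (cyclic_subgroup_graph G)) H =
    card {K \<in> cyclic_subgroups G. covered_by G H K \<or> covered_by G K H}"
proof -
  have "out_arcs (with_proj (cyclic_subgroup_graph G)) H =
      Pair H ` {K \<in> cyclic_subgroups G. covered_by G H K \<or> covered_by G K H}"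
    using assms by (auto simp: out_arcs_def cyclic_subgroup_graph_def)
  then show ?thesis
    by (simp add: out_degree_def card_image inj_on_def)
qed

end

theory Submission
  imports Defs "HOL-Algebra.Multiplicative_Group"
begin

text \<open>
  Write \<open>\<omega>(n)\<close> for the number of prime divisors of \<open>n\<close>. The subgroups of a finite cyclic group \<open>M\<close>
  correspond to the divisors of \<open>|M|\<close> (\<open>card_torsion\<close>, \<open>subgroup_eq_torsion\<close>), and one covers
  another exactly when it contains it with prime index (\<open>covered_by_cyclic_iff\<close>). So every cyclic
  subgroup \<open>H\<close> has \<open>\<omega>(|H|)\<close> lower neighbours, and it has \<open>\<omega>(|M| / |H|)\<close> upper neighbours inside
  a given cyclic subgroup \<open>M \<supseteq> H\<close>.

  If \<open>G\<close> is cyclic of square-free order \<open>n\<close>, a subgroup of order \<open>m\<close> therefore has degree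
  \<open>\<omega>(m) + \<omega>(n/m)\<close>, which is \<open>\<omega>(n)\<close> because \<open>m\<close> and \<open>n/m\<close> are coprime.

  Conversely, let the graph be regular of degree \<open>d\<close>, and let \<open>M\<close> be a maximal cyclic subgroup. It
  has no upper neighbours, so \<open>d = \<omega>(|M|)\<close>. The trivial subgroup has degree \<open>d\<close> too, and already
  \<open>\<omega>(|M|)\<close> neighbours inside \<open>M\<close>; hence every neighbour of the trivial subgroup lies in every
  maximal cyclic subgroup. If \<open>p\<^sup>2\<close> divided \<open>|M|\<close> for a prime \<open>p\<close>, the subgroup of order \<open>p\<close> of \<open>M\<close>
  would have degree at least \<open>1 + \<omega>(|M| / p) = 1 + \<omega>(|M|) > d\<close>; so \<open>|M|\<close> is square-free. For
  maximal cyclic subgroups \<open>M\<close> and \<open>N\<close>, the order of \<open>M \<inter> N\<close> is then divisible by every prime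
  divisor of the square-free number \<open>|M|\<close>, which forces \<open>M \<subseteq> N\<close>. Thus there is only one maximal
  cyclic subgroup. Every element of \<open>G\<close> lies in it, so it is \<open>G\<close>.
\<close>

section \<open>Orders of subgroups and generators of cyclic subgroups\<close>

locale finite_group = group +
  assumes finite_carrier: "finite (carrier G)"
begin

lemma finite_subgroup: "subgroup H G \<Longrightarrow> finite H"
  using finite_carrier finite_subset subgroup.subset by blast

lemma card_subgroup_dvd:
  assumes H: "subgroup H G" and K: "subgroup K G" and "H \<subseteq> K"
  shows "card H dvd card K"
proof -
  have "group (G\<lparr>carrier := K\<rparr>)"
    using K by (rule subgroup_imp_group)
  from group.lagrange[OF this subgroup_incl[OF assms]]
  have "card K = card (rcosets\<^bsub>G\<lparr>carrier := K\<rparr>\<^esub> H) * card H"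
    by (simp add: order_def)
  then show ?thesis
    by (rule dvdI[OF trans[OF _ mult.commute]])
qed

lemma card_subgroup_pos: "subgroup H G \<Longrightarrow> 0 < card H"
  by (metis card_gt_0_iff empty_iff finite_subgroup subgroup.one_closed)

lemma pow_card_subgroup:
  assumes H: "subgroup H G" and x: "x \<in> H"
  shows "x [^] card H = \<one>"
proof -
  have x': "x \<in> carrier G"
    using assms subgroup.subset by blast
  have "generate G {x} \<subseteq> H"
    using assms by (simp add: generate_subgroup_incl)
  then have "card (generate G {x}) dvd card H"
    using card_subgroup_dvd[OF generate_is_subgroup H] x' by simp
  then show ?thesis
    by (simp add: pow_eq_id[OF x'] generate_pow_card[OF x'])
qed

lemma cyclic_subgroups_eq: "cyclic_subgroups G = (\<lambda>x. generate G {x}) ` carrier G"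
proof (intro equalityI subsetI)
  fix H assume "H \<in> cyclic_subgroups G"
  then have H: "subgroup H G" and "cyclic_group (G\<lparr>carrier := H\<rparr>)"
    by (auto simp: cyclic_subgroups_def)
  then obtain x where x: "x \<in> H" "subgroup_generated (G\<lparr>carrier := H\<rparr>) {x} = G\<lparr>carrier := H\<rparr>"
    by (auto simp: cyclic_group_def)
  have "H = carrier (subgroup_generated (G\<lparr>carrier := H\<rparr>) {x})"
    by (subst x(2)) simp
  also have "\<dots> = generate G {x}"
    using x(1) H by (simp add: carrier_subgroup_generated generate_consistent)
  finally show "H \<in> (\<lambda>x. generate G {x}) ` carrier G"
    using x(1) subgroup.subset[OF H] by auto
next
  fix H assume "H \<in> (\<lambda>x. generate G {x}) ` carrier G"
  then obtain x where x: "x \<in> carrier G" and H: "H = generate G {x}"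
    by auto
  have "G\<lparr>carrier := H\<rparr> = subgroup_generated G {x}"
    using x H by (simp add: subgroup_generated_def)
  then show "H \<in> cyclic_subgroups G"
    using x H generate_is_subgroup[of "{x}"] cyclic_group_generated[of x]
    by (simp add: cyclic_subgroups_def)
qed

lemma subgroup_cyclic_subgroups: "H \<in> cyclic_subgroups G \<Longrightarrow> subgroup H G"
  by (simp add: cyclic_subgroups_def)

lemma trivial_cyclic_subgroup: "{\<one>} \<in> cyclic_subgroups G"
  unfolding cyclic_subgroups_eq using generate_one by force

section \<open>Subgroups of a finite cyclic group\<close>

text \<open>The elements of \<open>M\<close> whose order divides \<open>d\<close>. For a cyclic subgroup \<open>M\<close> and a divisor \<open>d\<close> of
  \<open>card M\<close>, this is the unique subgroup of \<open>M\<close> of order \<open>d\<close>.\<close>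

definition torsion :: "'a set \<Rightarrow> nat \<Rightarrow> 'a set" where
  "torsion M d = {y \<in> M. y [^] d = \<one>}"

lemma torsion_generate:
  assumes x: "x \<in> carrier G" and d: "d dvd ord x"
  shows "torsion (generate G {x}) d = generate G {x [^] (ord x div d)}"
proof -
  obtain c where c: "ord x = d * c"
    using d by blast
  have pos: "0 < d" "0 < c"
    using c ord_ge_1[OF finite_carrier x] by (auto intro!: Nat.gr0I)
  have gen: "generate G {z} = {z [^] k | k::nat. True}" if "z \<in> carrier G" for z
    using generate_pow_on_finite_carrier[OF finite_carrier that] by simp
  have "torsion (generate G {x}) d = {x [^] (c * j) | j. True}"
  proof (intro equalityI subsetI)
    fix y assume "y \<in> torsion (generate G {x}) d"
    then obtain k :: nat where y: "y = x [^] k" "(x [^] k) [^] d = \<one>"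
      by (auto simp: torsion_def gen x)
    then have "d * c dvd k * d"
      by (simp add: nat_pow_pow pow_eq_id x c)
    then have "c dvd k"
      using pos by (simp add: mult.commute)
    then show "y \<in> {x [^] (c * j) | j. True}"
      using y by auto
  next
    fix y assume "y \<in> {x [^] (c * j) | j. True}"
    then obtain j where y: "y = x [^] (c * j)"
      by auto
    have "ord x dvd c * j * d"
      by (simp add: c)
    then have "y [^] d = \<one>"
      by (simp only: y nat_pow_pow x pow_eq_id)
    then show "y \<in> torsion (generate G {x}) d"
      using y by (auto simp: torsion_def gen x)
  qed
  also have "\<dots> = generate G {x [^] c}"
    using x by (simp add: gen nat_pow_pow)
  finally show ?thesis
    using c pos by simp
qed

lemma
  assumes M: "M \<in> cyclic_subgroups G" and d: "d dvd card M"
  shows card_torsion: "card (torsion M d) = d"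
    and torsion_in_cyclic_subgroups: "torsion M d \<in> cyclic_subgroups G"
proof -
  obtain x where x: "x \<in> carrier G" and Mx: "M = generate G {x}"
    using M by (auto simp: cyclic_subgroups_eq)
  have d': "d dvd ord x"
    using d by (simp add: Mx generate_pow_card[OF x])
  have pos: "0 < ord x"
    using ord_ge_1[OF finite_carrier x] by simp
  have T: "torsion M d = generate G {x [^] (ord x div d)}"
    unfolding Mx using x d' by (rule torsion_generate)
  then show "torsion M d \<in> cyclic_subgroups G"
    using x by (simp add: cyclic_subgroups_eq)
  obtain c where c: "ord x = d * c"
    using d' by blast
  have pos': "0 < d" "0 < c"
    using c pos by (auto intro!: Nat.gr0I)
  have "ord (x [^] (ord x div d)) = ord x div (ord x div d)"
    using x pos' by (intro ord_pow) (auto simp: c)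
  also have "\<dots> = d"
    using pos' by (simp add: c)
  finally show "card (torsion M d) = d"
    by (simp add: T generate_pow_card x)
qed

lemma torsion_subset: "torsion M d \<subseteq> M"
  by (auto simp: torsion_def)

lemma subgroup_torsion:
  "M \<in> cyclic_subgroups G \<Longrightarrow> d dvd card M \<Longrightarrow> subgroup (torsion M d) G"
  by (intro subgroup_cyclic_subgroups torsion_in_cyclic_subgroups)

lemma subgroup_eq_torsion:
  assumes M: "M \<in> cyclic_subgroups G" and H: "subgroup H G" and "H \<subseteq> M"
  shows "H = torsion M (card H)"
proof (rule card_subset_eq)
  have d: "card H dvd card M"
    using card_subgroup_dvd[OF H subgroup_cyclic_subgroups[OF M] \<open>H \<subseteq> M\<close>] .
  show "finite (torsion M (card H))"
    using finite_subgroup subgroup_torsion[OF M d] by blast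
  show "H \<subseteq> torsion M (card H)"
    using pow_card_subgroup[OF H] \<open>H \<subseteq> M\<close> by (auto simp: torsion_def)
  show "card H = card (torsion M (card H))"
    by (simp add: card_torsion[OF M d])
qed

text \<open>Together with \<open>card_torsion\<close> and \<open>subgroup_eq_torsion\<close>, this makes the correspondence between
  subgroups of a cyclic group and divisors of its order monotone.\<close>

lemma subset_torsion:
  assumes H: "subgroup H G" and "H \<subseteq> M" and "card H dvd d"
  shows "H \<subseteq> torsion M d"
proof
  fix x assume x: "x \<in> H"
  then have "x \<in> carrier G"
    using H subgroup.subset by blast
  moreover have "x [^] card H = \<one>"
    using H x by (rule pow_card_subgroup)
  ultimately have "x [^] d = \<one>"
    using \<open>card H dvd d\<close> by (metis pow_eq_id dvd_trans)
  then show "x \<in> torsion M d"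
    using x \<open>H \<subseteq> M\<close> by (auto simp: torsion_def)
qed

section \<open>Covers and degrees\<close>

lemma covered_by_cyclic_iff:
  assumes K: "K \<in> cyclic_subgroups G" and H: "subgroup H G"
  shows "covered_by G H K \<longleftrightarrow> H \<subseteq> K \<and> (\<exists>p. prime p \<and> card K = p * card H)"
proof (intro iffI conjI)
  note K' = subgroup_cyclic_subgroups[OF K]
  assume cov: "covered_by G H K"
  then have HK: "H \<subset> K" and between: "\<And>L. subgroup L G \<Longrightarrow> H \<subset> L \<Longrightarrow> \<not> L \<subset> K"
    by (auto simp: covered_by_def)
  from HK show "H \<subseteq> K"
    by simp
  obtain c where c: "card K = c * card H"
    using card_subgroup_dvd[OF H K' \<open>H \<subseteq> K\<close>] by (metis dvd_def mult.commute)
  have "card H < card K"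
    using HK finite_subgroup[OF K'] by (simp add: psubset_card_mono)
  then have "c \<noteq> 1"
    using c by auto
  then obtain p where p: "prime p" "p dvd c"
    using prime_factor_nat by blast
  have d: "p * card H dvd card K"
    using p by (simp add: c)
  \<comment> \<open>The subgroup of \<open>K\<close> of order \<open>p * card H\<close> strictly contains \<open>H\<close>, so it can only be \<open>K\<close>.\<close>
  let ?L = "torsion K (p * card H)"
  have "H \<subseteq> ?L"
    using HK H by (intro subset_torsion) auto
  moreover have "card ?L \<noteq> card H"
    using card_torsion[OF K d] card_subgroup_pos[OF H] prime_gt_1_nat[OF p(1)] by simp
  ultimately have "H \<subset> ?L"
    by auto
  then have "?L = K"
    using between[OF subgroup_torsion[OF K d]] torsion_subset[of K] by blast
  then show "\<exists>p. prime p \<and> card K = p * card H"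
    using card_torsion[OF K d] p(1) by auto
next
  note K' = subgroup_cyclic_subgroups[OF K]
  assume "H \<subseteq> K \<and> (\<exists>p. prime p \<and> card K = p * card H)"
  then obtain p where HK: "H \<subseteq> K" and p: "prime p" "card K = p * card H"
    by auto
  have pos: "0 < card H"
    by (rule card_subgroup_pos[OF H])
  have "card H \<noteq> card K"
    using p pos prime_gt_1_nat[OF p(1)] by simp
  then have "H \<subset> K"
    using HK by auto
  moreover have False if L: "subgroup L G" "H \<subset> L" "L \<subset> K" for L
  proof -
    have fin: "finite L" "finite K"
      using L(1) K' by (auto intro: finite_subgroup)
    have lt: "card H < card L" "card L < card K"
      using L fin by (auto intro: psubset_card_mono)
    obtain a where a: "card L = card H * a"
      using card_subgroup_dvd[OF H L(1)] L(2) by (auto elim: dvdE)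
    obtain b where b: "card K = card L * b"
      using card_subgroup_dvd[OF L(1) K'] L(3) by (auto elim: dvdE)
    have "card H * (a * b) = card H * p"
      unfolding mult.assoc[symmetric] a[symmetric] b[symmetric] p(2) by (rule mult.commute)
    then have "a * b = p"
      using pos by (metis mult_left_cancel less_irrefl)
    then have "a = 1 \<or> b = 1"
      using p(1) prime_product by blast
    then show False
      using lt a b by auto
  qed
  ultimately show "covered_by G H K"
    by (auto simp: covered_by_def)
qed

lemma card_lower_covers:
  assumes H: "H \<in> cyclic_subgroups G"
  shows "card {K \<in> cyclic_subgroups G. covered_by G K H} = card (prime_factors (card H))"
proof -
  note H' = subgroup_cyclic_subgroups[OF H]
  have pos: "0 < card H"
    by (rule card_subgroup_pos[OF H'])
  have dvd: "card H div p dvd card H" if "p \<in> prime_factors (card H)" for p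
    using that by (metis dvd_triv_right dvd_mult_div_cancel in_prime_factors_iff)
  have "bij_betw (\<lambda>p. torsion H (card H div p)) (prime_factors (card H))
      {K \<in> cyclic_subgroups G. covered_by G K H}"
    unfolding bij_betw_def
  proof (intro conjI inj_onI equalityI subsetI)
    fix p q
    assume p: "p \<in> prime_factors (card H)" and q: "q \<in> prime_factors (card H)"
      and eq: "torsion H (card H div p) = torsion H (card H div q)"
    have "card H div p = card H div q"
      using card_torsion[OF H dvd[OF p]] card_torsion[OF H dvd[OF q]] unfolding eq by (rule trans[OF sym])
    moreover have "card H = p * (card H div p)" "card H = q * (card H div q)"
      using p q by (auto simp: in_prime_factors_iff)
    ultimately have "p * (card H div p) = q * (card H div p)" "card H div p \<noteq> 0"
      using pos by (metis, metis mult_0_right less_irrefl)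
    then show "p = q"
      by simp
  next
    fix K assume "K \<in> (\<lambda>p. torsion H (card H div p)) ` prime_factors (card H)"
    then obtain p where p: "p \<in> prime_factors (card H)" and K: "K = torsion H (card H div p)"
      by auto
    have "K \<in> cyclic_subgroups G"
      unfolding K by (intro torsion_in_cyclic_subgroups H dvd p)
    moreover have "card H = p * card K"
      using p unfolding K card_torsion[OF H dvd[OF p]] by (simp add: in_prime_factors_iff)
    moreover have "K \<subseteq> H" "prime p"
      using p by (auto simp: K torsion_subset in_prime_factors_iff)
    ultimately show "K \<in> {K \<in> cyclic_subgroups G. covered_by G K H}"
      using covered_by_cyclic_iff[OF H subgroup_cyclic_subgroups] by auto
  next
    fix K assume "K \<in> {K \<in> cyclic_subgroups G. covered_by G K H}"
    then have K: "subgroup K G" and cov: "covered_by G K H"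
      by (auto intro: subgroup_cyclic_subgroups)
    obtain p where p: "prime p" "card H = p * card K" and "K \<subseteq> H"
      using cov covered_by_cyclic_iff[OF H K] by auto
    then have "card K = card H div p"
      by (simp add: prime_gt_0_nat)
    then have "K = torsion H (card H div p)"
      using subgroup_eq_torsion[OF H K \<open>K \<subseteq> H\<close>] by simp
    moreover have "p \<in> prime_factors (card H)"
      using p pos by (auto simp: in_prime_factors_iff)
    ultimately show "K \<in> (\<lambda>p. torsion H (card H div p)) ` prime_factors (card H)"
      by blast
  qed
  then show ?thesis
    by (rule bij_betw_same_card[symmetric])
qed

lemma card_upper_covers_within:
  assumes M: "M \<in> cyclic_subgroups G" and H: "subgroup H G" and HM: "H \<subseteq> M"
  shows "card {K \<in> cyclic_subgroups G. covered_by G H K \<and> K \<subseteq> M}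
    = card (prime_factors (card M div card H))"
proof -
  note M' = subgroup_cyclic_subgroups[OF M]
  have pos: "0 < card H" "0 < card M"
    using card_subgroup_pos H M' by auto
  obtain c where c: "card M = c * card H"
    using card_subgroup_dvd[OF H M' HM] by (metis dvd_def mult.commute)
  have c': "card M div card H = c" "0 < c"
    using c pos by auto
  have dvd: "p * card H dvd card M" if "p \<in> prime_factors c" for p
    using that c by (auto simp: in_prime_factors_iff)
  have "bij_betw (\<lambda>p. torsion M (p * card H)) (prime_factors c)
      {K \<in> cyclic_subgroups G. covered_by G H K \<and> K \<subseteq> M}"
    unfolding bij_betw_def
  proof (intro conjI inj_onI equalityI subsetI)
    fix p q
    assume p: "p \<in> prime_factors c" and q: "q \<in> prime_factors c"
      and eq: "torsion M (p * card H) = torsion M (q * card H)"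
    have "p * card H = q * card H"
      using card_torsion[OF M dvd[OF p]] card_torsion[OF M dvd[OF q]] unfolding eq by (rule trans[OF sym])
    then show "p = q"
      using pos by simp
  next
    fix K assume "K \<in> (\<lambda>p. torsion M (p * card H)) ` prime_factors c"
    then obtain p where p: "p \<in> prime_factors c" and K: "K = torsion M (p * card H)"
      by auto
    have "K \<in> cyclic_subgroups G"
      unfolding K by (intro torsion_in_cyclic_subgroups M dvd p)
    moreover have "card K = p * card H"
      by (simp add: K card_torsion[OF M dvd[OF p]])
    moreover have "H \<subseteq> K"
      unfolding K using H HM by (rule subset_torsion) simp
    moreover have "K \<subseteq> M" "prime p"
      using p by (auto simp: K torsion_subset in_prime_factors_iff)
    ultimately show "K \<in> {K \<in> cyclic_subgroups G. covered_by G H K \<and> K \<subseteq> M}"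
      using covered_by_cyclic_iff[OF _ H] by auto
  next
    fix K assume "K \<in> {K \<in> cyclic_subgroups G. covered_by G H K \<and> K \<subseteq> M}"
    then have K: "K \<in> cyclic_subgroups G" and KM: "K \<subseteq> M" and cov: "covered_by G H K"
      by auto
    note K' = subgroup_cyclic_subgroups[OF K]
    obtain p where p: "prime p" "card K = p * card H"
      using cov covered_by_cyclic_iff[OF K H] by auto
    have "p * card H dvd c * card H"
      using card_subgroup_dvd[OF K' M' KM] p(2) c by simp
    then have "p \<in> prime_factors c"
      using p pos c' by (simp add: in_prime_factors_iff)
    moreover have "K = torsion M (p * card H)"
      using subgroup_eq_torsion[OF M K' KM] p(2) by simp
    ultimately show "K \<in> (\<lambda>p. torsion M (p * card H)) ` prime_factors c"
      by blast
  qed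
  then show ?thesis
    unfolding c'(1) by (rule bij_betw_same_card[symmetric])
qed

text \<open>The two summands count the neighbours of \<open>H\<close> below and above it.\<close>

lemma degree_eq:
  assumes H: "H \<in> cyclic_subgroups G"
  shows "out_degree (with_proj (cyclic_subgroup_graph G)) H =
    card (prime_factors (card H)) + card {K \<in> cyclic_subgroups G. covered_by G H K}"
proof -
  have fin: "finite (cyclic_subgroups G)"
    using finite_carrier by (rule finite_cyclic_subgroups)
  have "{K \<in> cyclic_subgroups G. covered_by G H K \<or> covered_by G K H} =
      {K \<in> cyclic_subgroups G. covered_by G K H} \<union> {K \<in> cyclic_subgroups G. covered_by G H K}"
    by auto
  moreover have "{K \<in> cyclic_subgroups G. covered_by G K H} \<inter>
      {K \<in> cyclic_subgroups G. covered_by G H K} = {}"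
    by (auto simp: covered_by_def)
  ultimately show ?thesis
    using fin by (simp add: out_degree_cyclic_subgroup_graph[OF H] card_Un_disjoint card_lower_covers[OF H])
qed

section \<open>Regularity\<close>

lemma cyclic_squarefree_imp_regular:
  assumes "cyclic_group G" and "squarefree (order G)"
  shows "regular_graph (cyclic_subgroup_graph G)"
  unfolding regular_graph_def
proof (intro exI ballI)
  fix H assume "H \<in> pverts (cyclic_subgroup_graph G)"
  then have H: "H \<in> cyclic_subgroups G"
    by (simp add: cyclic_subgroup_graph_def)
  note H' = subgroup_cyclic_subgroups[OF H]
  have M: "carrier G \<in> cyclic_subgroups G"
    using assms(1) subgroup_self by (simp add: cyclic_subgroups_def)
  have sub: "K \<subseteq> carrier G" if "K \<in> cyclic_subgroups G" for K
    using that subgroup_cyclic_subgroups subgroup.subset by blast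
  obtain c where c: "order G = card H * c"
    using card_subgroup_dvd[OF H' subgroup_self sub[OF H]] by (auto simp: order_def)
  have pos: "0 < card H" "0 < c"
    using card_subgroup_pos[OF H'] c assms(2) by (auto intro: Nat.gr0I)
  have "{K \<in> cyclic_subgroups G. covered_by G H K}
      = {K \<in> cyclic_subgroups G. covered_by G H K \<and> K \<subseteq> carrier G}"
    using sub by auto
  then have "card {K \<in> cyclic_subgroups G. covered_by G H K} = card (prime_factors c)"
    using card_upper_covers_within[OF M H' sub[OF H]] c pos by (simp add: order_def)
  moreover have "prime_factors (card H) \<inter> prime_factors c = {}"
  proof -
    have "\<not> (prime p \<and> p dvd card H \<and> p dvd c)" for p
      using assms(2) squarefreeD[of "order G" p] mult_dvd_mono[of p "card H" p c]
      by (auto simp: c power2_eq_square)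
    then show ?thesis
      by (auto simp: in_prime_factors_iff)
  qed
  ultimately show "out_degree (with_proj (cyclic_subgroup_graph G)) H
      = card (prime_factors (order G))"
    using pos by (simp add: degree_eq[OF H] c prime_factors_product card_Un_disjoint)
qed

lemma regular_imp_cyclic_squarefree:
  assumes "regular_graph (cyclic_subgroup_graph G)"
  shows "cyclic_group G \<and> squarefree (order G)"
proof -
  let ?C = "cyclic_subgroups G"
  define maximal where "maximal M \<longleftrightarrow> M \<in> ?C \<and> (\<forall>K\<in>?C. M \<subseteq> K \<longrightarrow> M = K)" for M
  have fin: "finite ?C"
    using finite_carrier by (rule finite_cyclic_subgroups)
  have "pverts (cyclic_subgroup_graph G) = ?C"
    by (simp add: cyclic_subgroup_graph_def)
  then obtain d where d: "out_degree (with_proj (cyclic_subgroup_graph G)) H = d" if "H \<in> ?C" for H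
    using assms unfolding regular_graph_def by metis
  have ex_max: "\<exists>M. maximal M \<and> H \<subseteq> M" if "H \<in> ?C" for H
    using finite_has_maximal2[OF fin that] by (auto simp: maximal_def)
  have d_max: "d = card (prime_factors (card M))" if "maximal M" for M
  proof -
    have M: "M \<in> ?C"
      using that by (simp add: maximal_def)
    have no_cover: "{K \<in> ?C. covered_by G M K} = {}"
      using that by (auto simp: maximal_def covered_by_def)
    show ?thesis
      using d[OF M] degree_eq[OF M] unfolding no_cover by simp
  qed
  \<comment> \<open>\<open>M\<close> alone accounts for all \<open>d\<close> neighbours of the trivial subgroup.\<close>
  have atoms: "K \<subseteq> M" if M: "maximal M" and K: "K \<in> ?C" "covered_by G {\<one>} K" for M K
  proof -
    have M': "M \<in> ?C" "\<one> \<in> M"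
      using M by (auto simp: maximal_def dest: subgroup_cyclic_subgroups subgroup.one_closed)
    have "card {K \<in> ?C. covered_by G {\<one>} K} = d"
      using degree_eq[OF trivial_cyclic_subgroup] d[OF trivial_cyclic_subgroup] by simp
    moreover have "card {K \<in> ?C. covered_by G {\<one>} K \<and> K \<subseteq> M} = d"
      using card_upper_covers_within[OF M'(1) triv_subgroup] M' d_max[OF M] by simp
    ultimately have "{K \<in> ?C. covered_by G {\<one>} K \<and> K \<subseteq> M} = {K \<in> ?C. covered_by G {\<one>} K}"
      using fin by (intro card_subset_eq) auto
    then show ?thesis
      using K by blast
  qed
  have sqf: "squarefree (card M)" if M: "maximal M" for M
  proof (rule ccontr)
    have M': "M \<in> ?C"
      using M by (simp add: maximal_def)
    have pos: "0 < card M"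
      using M' by (intro card_subgroup_pos subgroup_cyclic_subgroups)
    assume "\<not> squarefree (card M)"
    then obtain p where p: "prime p" "p\<^sup>2 dvd card M"
      using pos squarefree_factorial_semiring[of "card M"] by auto
    then obtain b where b: "card M = p * (p * b)"
      by (auto simp: power2_eq_square mult.assoc dvd_def)
    have pdvd: "p dvd card M"
      by (simp add: b)
    define H where "H = torsion M p"
    have H: "H \<in> ?C" "card H = p" "H \<subseteq> M"
      unfolding H_def using M' pdvd by (simp_all add: torsion_in_cyclic_subgroups card_torsion torsion_subset)
    \<comment> \<open>Dividing by \<open>p\<close> loses no prime divisor, so \<open>H\<close> has \<open>d\<close> covers inside \<open>M\<close>, while the
      trivial subgroup adds one more neighbour.\<close>
    have quot: "prime_factors (card M div p) = prime_factors (card M)"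
    proof -
      have "card M div p = p * b" "p * b \<noteq> 0"
        using pos b p(1) by auto
      then have "prime_factors (card M) = insert p (prime_factors (p * b))"
        "prime_factors (p * b) = insert p (prime_factors b)"
        using p(1) unfolding b by (subst prime_factors_product; simp add: prime_factorization_prime)+
      then show ?thesis
        using \<open>card M div p = p * b\<close> by simp
    qed
    have "d = card (prime_factors (card M div p))"
      by (simp add: quot d_max[OF M])
    also have "\<dots> = card {K \<in> ?C. covered_by G H K \<and> K \<subseteq> M}"
      using card_upper_covers_within[OF M' subgroup_cyclic_subgroups[OF H(1)] H(3)] H(2) by simp
    also have "\<dots> \<le> card {K \<in> ?C. covered_by G H K}"
      using fin by (intro card_mono) auto
    also have "\<dots> < 1 + card {K \<in> ?C. covered_by G H K}"
      by simp
    also have "\<dots> = d"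
      using degree_eq[OF H(1)] d[OF H(1)] H(2) p(1) by (simp add: prime_factorization_prime)
    finally show False
      by simp
  qed
  have max_le: "M \<subseteq> N" if M: "maximal M" and N: "maximal N" for M N
  proof -
    have MN: "M \<in> ?C" "N \<in> ?C" "subgroup M G" "subgroup N G"
      using M N by (auto simp: maximal_def dest: subgroup_cyclic_subgroups)
    have I: "subgroup (M \<inter> N) G"
      using MN by (intro subgroups_Inter_pair)
    obtain c where c: "card M = card (M \<inter> N) * c"
      using card_subgroup_dvd[OF I MN(3) Int_lower1] by (rule dvdE)
    \<comment> \<open>A prime divisor of the index \<open>c\<close> would also divide \<open>card (M \<inter> N)\<close>, because the subgroup of
      that order in \<open>M\<close> covers the trivial subgroup and so lies in \<open>N\<close>.\<close>
    have "c = 1"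
    proof (rule ccontr)
      assume "c \<noteq> 1"
      then obtain p where p: "prime p" "p dvd c"
        using prime_factor_nat by blast
      then have pdvd: "p dvd card M"
        by (simp add: c)
      let ?T = "torsion M p"
      have T: "?T \<in> ?C" "card ?T = p" "subgroup ?T G"
        using MN pdvd by (simp_all add: torsion_in_cyclic_subgroups card_torsion subgroup_torsion)
      have "covered_by G {\<one>} ?T"
        using covered_by_cyclic_iff[OF T(1) triv_subgroup] T(2) p(1) subgroup.one_closed[OF T(3)] by simp
      then have "?T \<subseteq> M \<inter> N"
        using atoms[OF N T(1)] torsion_subset by blast
      then have "p dvd card (M \<inter> N)"
        using card_subgroup_dvd[OF T(3) I] T(2) by simp
      then have "p\<^sup>2 dvd card M"
        using p(2) unfolding c power2_eq_square by (rule mult_dvd_mono)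
      then have "p dvd 1"
        by (rule squarefreeD[OF sqf[OF M]])
      then show False
        using p(1) by simp
    qed
    then have "M \<inter> N = M"
      using c finite_subgroup[OF MN(3)] by (intro card_subset_eq) auto
    then show ?thesis
      by blast
  qed
  obtain M where M: "maximal M"
    using ex_max[OF trivial_cyclic_subgroup] by blast
  then have M': "M \<in> ?C"
    by (simp add: maximal_def)
  have "carrier G \<subseteq> M"
  proof
    fix x assume x: "x \<in> carrier G"
    then have "generate G {x} \<in> ?C"
      by (simp add: cyclic_subgroups_eq)
    then obtain N where N: "maximal N" "generate G {x} \<subseteq> N"
      using ex_max by blast
    then show "x \<in> M"
      using max_le[OF N(1) M] generate.incl[of x "{x}" G] by auto
  qed
  then have "M = carrier G"
    using subgroup.subset[OF subgroup_cyclic_subgroups[OF M']] by auto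
  then show ?thesis
    using M' sqf[OF M] by (simp add: cyclic_subgroups_def order_def)
qed

end

theorem proposition2p10:
  fixes G :: "('a, 'b) monoid_scheme"
  assumes "group G" and "finite (carrier G)"
  shows "regular_graph (cyclic_subgroup_graph G) \<longleftrightarrow> cyclic_group G \<and> squarefree (order G)"
proof -
  interpret finite_group G
    using assms by (simp add: finite_group_def finite_group_axioms_def)
  show ?thesis
    using regular_imp_cyclic_squarefree cyclic_squarefree_imp_regular by blast
qed

end
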